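(* Let $(\mathfrak g,B,\omega)$ be a quadratic Rota-Baxter mock-pre-Lie algebra of weight $\lambda$ and $\mathcal I_\omega:\mathfrak g^*\to\mathfrak g$ the induced linear isomorphism given by $\langle\mathcal I_\omega^{-1}x,y\rangle=\omega(x,y)$. Then the element $r=r^{B,\omega}\in\mathfrak g\otimes\mathfrak g$ defined by $$r^{B,\omega}_+:=B\circ\mathcal I_\omega:\mathfrak g^*\to\mathfrak g,\qquad r^{B,\omega}_+(\xi)=r^{B,\omega}(\xi,\cdot)\quad\text{for all }\xi\in\mathfrak g^*,$$ satisfies $[[r,r]]=0$, and gives rise to a triangular (if $\lambda=0$) or a factorizable (if $\lambda\neq0$) mock-pre-Lie bialgebra $(\mathfrak g,\mathfrak g^*_{r^{B,\omega}})$.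
   Context: All vector spaces are finite-dimensional over an algebraically closed field $\mathbb K$ of characteristic $0$. A mock-pre-Lie algebra is a vector space with a bilinear product satisfying $(x\cdot y)\cdot z+x\cdot(y\cdot z)=-(y\cdot x)\cdot z-y\cdot(x\cdot z)$. Write $\{x,y\}_c=x\cdot_{\mathfrak g}y+y\cdot_{\mathfrak g}x$, $L_xy=x\cdot_{\mathfrak g}y$, $R_xy=y\cdot_{\mathfrak g}x$, $\langle L_x^*\xi,y\rangle=-\langle\xi,x\cdot_{\mathfrak g}y\rangle$, $\langle R_x^*\xi,y\rangle=-\langle\xi,y\cdot_{\mathfrak g}x\rangle$. A Rota-Baxter operator of weight $\lambda$ on $(\mathfrak g,\cdot_{\mathfrak g})$ is a linear map $B:\mathfrak g\to\mathfrak g$ with $(Bx)\cdot_{\mathfrak g}(By)=B((Bx)\cdot_{\mathfrak g}y+x\cdot_{\mathfrak g}(By)+\lambda x\cdot_{\mathfrak g}y)$. A quadratic Rota-Baxter mock-pre-Lie algebra of weight $\lambda$, $(\mathfrak g,B,\omega)$, is a mock-pre-Lie algebra with a Rota-Baxter operator $B$ of weight $\lambda$ and a nondegenerate skew-symmetric bilinear form $\omega$ such that $\omega(x\cdot_{\mathfrak g}y,z)=\omega(y,\{x,z\}_c)$ and $\omega(Bx,y)+\omega(x,By)+\lambda\omega(x,y)=0$ for all $x,y,z$. For $r\in\mathfrak g\otimes\mathfrak g$ define $r_\pm:\mathfrak g^*\to\mathfrak g$ by $\langle r_+(\xi),\eta\rangle=r(\xi,\eta)$, $\langle r_-(\xi),\eta\rangle=r(\eta,\xi)$,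 and $I=r_+-r_-$. For $r=\sum_ia_i\otimes b_i$ let $$[[r,r]]=\sum_{i,j}\big(-a_i\cdot_{\mathfrak g}a_j\otimes b_j\otimes b_i-b_j\otimes a_i\cdot_{\mathfrak g}a_j\otimes b_i+a_j\otimes\{a_i,b_j\}_c\otimes b_i+\{a_i,b_j\}_c\otimes a_j\otimes b_i-a_i\otimes a_j\otimes\{b_i,b_j\}_c\big).$$ An element $s\in\mathfrak g\otimes\mathfrak g$ is $(L,L+R)$-invariant if $(L_x\otimes\mathrm{Id}-\mathrm{Id}\otimes(L_x+R_x))s=0$ for all $x$. Mock-pre-Lie bialgebra induced by $r$: let $\alpha(x)=(\mathrm{Id}\otimes R_x+\mathrm{Id}\otimes L_x-L_x\otimes\mathrm{Id})r$, whose dual product on $\mathfrak g^*$ is $\xi\cdot_r\eta=-(L^*_{r_+(\xi)}+R^*_{r_+(\xi)})\eta+R^*_{r_-(\eta)}\xi$; write $\mathfrak g_r^*=(\mathfrak g^*,\cdot_r)$, with left and right multiplications $\mathcal L,\mathcal R$ and $\{\xi,\eta\}_{\mathfrak g^*}=\xi\cdot_r\eta+\eta\cdot_r\xi$; let $\beta:\mathfrak g^*\to\mathfrak g^*\otimes\mathfrak g^*$ be the dual of $\cdot_{\mathfrak g}$. $(\mathfrak g,\mathfrak g_r^* )$ is a mock-pre-Lie bialgebra if $\cdot_r$ is a mock-pre-Lie product and $\alpha\{x,y\}_c=-(\mathrm{Id}\otimes(R_y+L_y)+L_y\otimes\mathrm{Id})\alpha(x)-(\mathrm{Id}\otimes(L_x+R_x)+L_x\otimes\mathrm{Id})\alpha(y)$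 and $\beta\{\xi,\eta\}_{\mathfrak g^*}=-(\mathrm{Id}\otimes(\mathcal R_\eta+\mathcal L_\eta)+\mathcal L_\eta\otimes\mathrm{Id})\beta(\xi)-(\mathrm{Id}\otimes(\mathcal L_\xi+\mathcal R_\xi)+\mathcal L_\xi\otimes\mathrm{Id})\beta(\eta)$. When $[[r,r]]=0$ and the skew-symmetric part $r_a$ of $r$ is $(L,L+R)$-invariant, the mock-pre-Lie bialgebra $(\mathfrak g,\mathfrak g_r^* )$ is called quasi-triangular; it is triangular if moreover $r$ is symmetric, and factorizable if moreover $I:\mathfrak g^*\to\mathfrak g$ is a linear isomorphism (equivalently $r_a$ is nondegenerate). *)

theory Defs
  imports
    "HOL-Computational_Algebra.Polynomial"
    "HOL-Library.Function_Algebras"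
begin

text \<open>
  A finite-dimensional vector space is a type \<open>'v\<close> with a scalar multiplication \<open>sc\<close> over \<open>'k\<close>;
  its dual is a subspace of \<open>'v \<Rightarrow> 'k\<close>, with the pointwise operations.  As the space is
  finite-dimensional, elements of \<open>\<gg> \<otimes> \<gg>\<close> and \<open>\<gg> \<otimes> \<gg> \<otimes> \<gg>\<close> are represented by the
  multilinear forms they induce on the dual, \<open>r \<xi> \<eta> = r(\<xi>, \<eta>)\<close>; elements of
  \<open>\<gg>\<^sup>* \<otimes> \<gg>\<^sup>*\<close> are represented by bilinear forms on \<open>\<gg>\<close>.  Values of a tensor at
  arguments outside the dual are meaningless, so that tensors are compared on the dual only.
\<close>

type_synonym ('k, 'v) tens2 = "('v \<Rightarrow> 'k) \<Rightarrow> ('v \<Rightarrow> 'k) \<Rightarrow> 'k"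
type_synonym ('k, 'v) tens3 = "('v \<Rightarrow> 'k) \<Rightarrow> ('v \<Rightarrow> 'k) \<Rightarrow> ('v \<Rightarrow> 'k) \<Rightarrow> 'k"

definition dual :: "('k::field \<Rightarrow> 'v::ab_group_add \<Rightarrow> 'v) \<Rightarrow> ('v \<Rightarrow> 'k) set" where
  "dual sc = {\<xi>. Vector_Spaces.linear sc (*) \<xi>}"

definition dual_scale :: "'k::field \<Rightarrow> ('v \<Rightarrow> 'k) \<Rightarrow> 'v \<Rightarrow> 'k" where
  "dual_scale c \<xi> = (\<lambda>x. c * \<xi> x)"

definition tensor_square :: "('k::field \<Rightarrow> 'v::ab_group_add \<Rightarrow> 'v) \<Rightarrow> ('k, 'v) tens2 set" where
  "tensor_square sc = {r.
     (\<forall>\<xi>\<in>dual sc. \<forall>\<eta>\<in>dual sc. \<forall>\<zeta>\<in>dual sc.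
        r (\<xi> + \<eta>) \<zeta> = r \<xi> \<zeta> + r \<eta> \<zeta> \<and> r \<zeta> (\<xi> + \<eta>) = r \<zeta> \<xi> + r \<zeta> \<eta>) \<and>
     (\<forall>c. \<forall>\<xi>\<in>dual sc. \<forall>\<eta>\<in>dual sc.
        r (dual_scale c \<xi>) \<eta> = c * r \<xi> \<eta> \<and> r \<xi> (dual_scale c \<eta>) = c * r \<xi> \<eta>)}"

definition eq2 :: "('k::field \<Rightarrow> 'v::ab_group_add \<Rightarrow> 'v) \<Rightarrow> ('k, 'v) tens2 \<Rightarrow> ('k, 'v) tens2 \<Rightarrow> bool" where
  "eq2 sc s t \<longleftrightarrow> (\<forall>\<xi>\<in>dual sc. \<forall>\<eta>\<in>dual sc. s \<xi> \<eta> = t \<xi> \<eta>)"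

definition eq3 :: "('k::field \<Rightarrow> 'v::ab_group_add \<Rightarrow> 'v) \<Rightarrow> ('k, 'v) tens3 \<Rightarrow> ('k, 'v) tens3 \<Rightarrow> bool" where
  "eq3 sc s t \<longleftrightarrow> (\<forall>\<xi>\<in>dual sc. \<forall>\<eta>\<in>dual sc. \<forall>\<zeta>\<in>dual sc. s \<xi> \<eta> \<zeta> = t \<xi> \<eta> \<zeta>)"

definition pure2 :: "'v \<Rightarrow> 'v \<Rightarrow> ('k::field, 'v) tens2" where
  "pure2 a b = (\<lambda>\<xi> \<eta>. \<xi> a * \<eta> b)"

definition pure3 :: "'v \<Rightarrow> 'v \<Rightarrow> 'v \<Rightarrow> ('k::field, 'v) tens3" where
  "pure3 a b c = (\<lambda>\<xi> \<eta> \<zeta>. \<xi> a * \<eta> b * \<zeta> c)"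

text \<open>\<open>(f \<otimes> g) (a \<otimes> b) = f a \<otimes> g b\<close>, in terms of the induced form\<close>

definition map2 :: "('v \<Rightarrow> 'v) \<Rightarrow> ('v \<Rightarrow> 'v) \<Rightarrow> ('k, 'v) tens2 \<Rightarrow> ('k, 'v) tens2" where
  "map2 f g r = (\<lambda>\<xi> \<eta>. r (\<xi> \<circ> f) (\<eta> \<circ> g))"

text \<open>
  \<open>S \<otimes> T\<close> on \<open>\<gg>\<^sup>* \<otimes> \<gg>\<^sup>*\<close>: if \<open>t x y = (\<Sum>i. \<xi>\<^sub>i x * \<eta>\<^sub>i y)\<close>, then the result is
  \<open>\<lambda>x y. \<Sum>i. S \<xi>\<^sub>i x * T \<eta>\<^sub>i y\<close>.
\<close>

definition dual_map2 ::
  "(('v \<Rightarrow> 'k) \<Rightarrow> 'v \<Rightarrow> 'k) \<Rightarrow> (('v \<Rightarrow> 'k) \<Rightarrow> 'v \<Rightarrow> 'k) \<Rightarrow> ('v \<Rightarrow> 'v \<Rightarrow> 'k) \<Rightarrow> 'v \<Rightarrow> 'v \<Rightarrow> 'k" where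
  "dual_map2 S T t = (\<lambda>x y. S (\<lambda>u. T (t u) y) x)"


subsection \<open>Mock-pre-Lie algebras\<close>

text \<open>The carrier \<open>V\<close> allows for the dual space as underlying space.\<close>

definition bilinear_product :: "('k \<Rightarrow> 'a \<Rightarrow> 'a) \<Rightarrow> 'a set \<Rightarrow> ('a::ab_group_add \<Rightarrow> 'a \<Rightarrow> 'a) \<Rightarrow> bool" where
  "bilinear_product sc V m \<longleftrightarrow>
     (\<forall>x\<in>V. \<forall>y\<in>V. m x y \<in> V) \<and>
     (\<forall>x\<in>V. \<forall>y\<in>V. \<forall>z\<in>V. m (x + y) z = m x z + m y z \<and> m z (x + y) = m z x + m z y) \<and>
     (\<forall>c. \<forall>x\<in>V. \<forall>y\<in>V. m (sc c x) y = sc c (m x y) \<and> m x (sc c y) = sc c (m x y))"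

definition mock_pre_lie :: "('k \<Rightarrow> 'a \<Rightarrow> 'a) \<Rightarrow> 'a set \<Rightarrow> ('a::ab_group_add \<Rightarrow> 'a \<Rightarrow> 'a) \<Rightarrow> bool" where
  "mock_pre_lie sc V m \<longleftrightarrow> bilinear_product sc V m \<and>
     (\<forall>x\<in>V. \<forall>y\<in>V. \<forall>z\<in>V. m (m x y) z + m x (m y z) = - m (m y x) z - m y (m x z))"

definition acomm :: "('a::ab_group_add \<Rightarrow> 'a \<Rightarrow> 'a) \<Rightarrow> 'a \<Rightarrow> 'a \<Rightarrow> 'a" where
  "acomm m x y = m x y + m y x"

definition Lmul :: "('a \<Rightarrow> 'a \<Rightarrow> 'a) \<Rightarrow> 'a \<Rightarrow> 'a \<Rightarrow> 'a" where
  "Lmul m x y = m x y"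

definition Rmul :: "('a \<Rightarrow> 'a \<Rightarrow> 'a) \<Rightarrow> 'a \<Rightarrow> 'a \<Rightarrow> 'a" where
  "Rmul m x y = m y x"

definition Lstar :: "('v \<Rightarrow> 'v \<Rightarrow> 'v) \<Rightarrow> 'v \<Rightarrow> ('v \<Rightarrow> 'k::field) \<Rightarrow> 'v \<Rightarrow> 'k" where
  "Lstar m x \<xi> = (\<lambda>y. - \<xi> (m x y))"

definition Rstar :: "('v \<Rightarrow> 'v \<Rightarrow> 'v) \<Rightarrow> 'v \<Rightarrow> ('v \<Rightarrow> 'k::field) \<Rightarrow> 'v \<Rightarrow> 'k" where
  "Rstar m x \<xi> = (\<lambda>y. - \<xi> (m y x))"

definition rota_baxter ::
  "('k::field \<Rightarrow> 'v::ab_group_add \<Rightarrow> 'v) \<Rightarrow> ('v \<Rightarrow> 'v \<Rightarrow> 'v) \<Rightarrow> 'k \<Rightarrow> ('v \<Rightarrow> 'v) \<Rightarrow> bool" where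
  "rota_baxter sc m l B \<longleftrightarrow> Vector_Spaces.linear sc sc B \<and>
     (\<forall>x y. m (B x) (B y) = B (m (B x) y + m x (B y) + sc l (m x y)))"

definition nondegenerate_skew_form ::
  "('k::field \<Rightarrow> 'v::ab_group_add \<Rightarrow> 'v) \<Rightarrow> ('v \<Rightarrow> 'v \<Rightarrow> 'k) \<Rightarrow> bool" where
  "nondegenerate_skew_form sc \<omega> \<longleftrightarrow>
     (\<forall>x. Vector_Spaces.linear sc (*) (\<lambda>y. \<omega> x y)) \<and>
     (\<forall>y. Vector_Spaces.linear sc (*) (\<lambda>x. \<omega> x y)) \<and>
     (\<forall>x y. \<omega> x y = - \<omega> y x) \<and>
     (\<forall>x. (\<forall>y. \<omega> x y = 0) \<longrightarrow> x = 0)"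

definition quadratic_rota_baxter ::
  "('k::field \<Rightarrow> 'v::ab_group_add \<Rightarrow> 'v) \<Rightarrow> ('v \<Rightarrow> 'v \<Rightarrow> 'v) \<Rightarrow> 'k \<Rightarrow> ('v \<Rightarrow> 'v) \<Rightarrow> ('v \<Rightarrow> 'v \<Rightarrow> 'k) \<Rightarrow> bool" where
  "quadratic_rota_baxter sc m l B \<omega> \<longleftrightarrow>
     mock_pre_lie sc UNIV m \<and> rota_baxter sc m l B \<and> nondegenerate_skew_form sc \<omega> \<and>
     (\<forall>x y z. \<omega> (m x y) z = \<omega> y (acomm m x z)) \<and>
     (\<forall>x y. \<omega> (B x) y + \<omega> x (B y) + l * \<omega> x y = 0)"

text \<open>The curried form \<open>\<omega>\<close> is itself the map \<open>x \<mapsto> \<omega>(x, \<cdot>)\<close> from \<open>\<gg>\<close> to its dual.\<close>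

definition form_iso :: "('v \<Rightarrow> 'v \<Rightarrow> 'k) \<Rightarrow> ('v \<Rightarrow> 'k) \<Rightarrow> 'v" where
  "form_iso \<omega> = inv \<omega>"


subsection \<open>Tensors as maps from the dual\<close>

definition r_plus ::
  "('k::field \<Rightarrow> 'v::ab_group_add \<Rightarrow> 'v) \<Rightarrow> ('k, 'v) tens2 \<Rightarrow> ('v \<Rightarrow> 'k) \<Rightarrow> 'v" where
  "r_plus sc r \<xi> = (THE v. \<forall>\<eta>\<in>dual sc. \<eta> v = r \<xi> \<eta>)"

definition r_minus ::
  "('k::field \<Rightarrow> 'v::ab_group_add \<Rightarrow> 'v) \<Rightarrow> ('k, 'v) tens2 \<Rightarrow> ('v \<Rightarrow> 'k) \<Rightarrow> 'v" where
  "r_minus sc r \<xi> = (THE v. \<forall>\<eta>\<in>dual sc. \<eta> v = r \<eta> \<xi>)"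

definition I_map ::
  "('k::field \<Rightarrow> 'v::ab_group_add \<Rightarrow> 'v) \<Rightarrow> ('k, 'v) tens2 \<Rightarrow> ('v \<Rightarrow> 'k) \<Rightarrow> 'v" where
  "I_map sc r \<xi> = r_plus sc r \<xi> - r_minus sc r \<xi>"

text \<open>The tensor \<open>r\<close> with \<open>r\<^sub>+ = T\<close>, i.e. \<open>r(\<xi>, \<cdot>) = T \<xi>\<close>\<close>

definition tensor_of_map :: "(('v \<Rightarrow> 'k) \<Rightarrow> 'v) \<Rightarrow> ('k, 'v) tens2" where
  "tensor_of_map T = (\<lambda>\<xi> \<eta>. \<eta> (T \<xi>))"

definition symmetric_tensor ::
  "('k::field \<Rightarrow> 'v::ab_group_add \<Rightarrow> 'v) \<Rightarrow> ('k, 'v) tens2 \<Rightarrow> bool" where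
  "symmetric_tensor sc r \<longleftrightarrow> eq2 sc r (\<lambda>\<xi> \<eta>. r \<eta> \<xi>)"

definition skew_part :: "('k::field, 'v) tens2 \<Rightarrow> ('k, 'v) tens2" where
  "skew_part r = (\<lambda>\<xi> \<eta>. (r \<xi> \<eta> - r \<eta> \<xi>) / 2)"

definition L_LR_invariant ::
  "('k::field \<Rightarrow> 'v::ab_group_add \<Rightarrow> 'v) \<Rightarrow> ('v \<Rightarrow> 'v \<Rightarrow> 'v) \<Rightarrow> ('k, 'v) tens2 \<Rightarrow> bool" where
  "L_LR_invariant sc m s \<longleftrightarrow>
     (\<forall>x. eq2 sc (map2 (Lmul m x) id s - map2 id (Lmul m x + Rmul m x) s) 0)"


subsection \<open>The element \<open>[[r, r]]\<close>\<close>

text \<open>A list of pairs \<open>(a\<^sub>i, b\<^sub>i)\<close> stands for \<open>\<Sum>i. a\<^sub>i \<otimes> b\<^sub>i\<close>.\<close>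

definition tensor_of_list :: "('v \<times> 'v) list \<Rightarrow> ('k::field, 'v) tens2" where
  "tensor_of_list ps = (\<Sum>(a, b)\<leftarrow>ps. pure2 a b)"

definition bracket_of_list ::
  "('v::ab_group_add \<Rightarrow> 'v \<Rightarrow> 'v) \<Rightarrow> ('v \<times> 'v) list \<Rightarrow> ('k::field, 'v) tens3" where
  "bracket_of_list m ps =
     (\<Sum>(ai, bi)\<leftarrow>ps. \<Sum>(aj, bj)\<leftarrow>ps.
        - pure3 (m ai aj) bj bi
        - pure3 bj (m ai aj) bi
        + pure3 aj (acomm m ai bj) bi
        + pure3 (acomm m ai bj) aj bi
        - pure3 ai aj (acomm m bi bj))"

text \<open>
  The choice of the decomposition is immaterial, and there is one for every \<open>r \<in> \<gg> \<otimes> \<gg>\<close>: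
  see \<open>bracket_eq\<close> and \<open>tensor_decomposition\<close> below.
\<close>

definition bracket ::
  "('k::field \<Rightarrow> 'v::ab_group_add \<Rightarrow> 'v) \<Rightarrow> ('v \<Rightarrow> 'v \<Rightarrow> 'v) \<Rightarrow> ('k, 'v) tens2 \<Rightarrow> ('k, 'v) tens3" where
  "bracket sc m r = bracket_of_list m (SOME ps. eq2 sc r (tensor_of_list ps))"


subsection \<open>The bialgebra induced by \<open>r\<close>\<close>

definition alpha :: "('v::ab_group_add \<Rightarrow> 'v \<Rightarrow> 'v) \<Rightarrow> ('k::field, 'v) tens2 \<Rightarrow> 'v \<Rightarrow> ('k, 'v) tens2" where
  "alpha m r x = map2 id (Rmul m x) r + map2 id (Lmul m x) r - map2 (Lmul m x) id r"

definition dual_mul ::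
  "('k::field \<Rightarrow> 'v::ab_group_add \<Rightarrow> 'v) \<Rightarrow> ('v \<Rightarrow> 'v \<Rightarrow> 'v) \<Rightarrow> ('k, 'v) tens2 \<Rightarrow>
   ('v \<Rightarrow> 'k) \<Rightarrow> ('v \<Rightarrow> 'k) \<Rightarrow> 'v \<Rightarrow> 'k" where
  "dual_mul sc m r \<xi> \<eta> =
     - (Lstar m (r_plus sc r \<xi>) \<eta> + Rstar m (r_plus sc r \<xi>) \<eta>) + Rstar m (r_minus sc r \<eta>) \<xi>"

definition beta :: "('v \<Rightarrow> 'v \<Rightarrow> 'v) \<Rightarrow> ('v \<Rightarrow> 'k) \<Rightarrow> 'v \<Rightarrow> 'v \<Rightarrow> 'k" where
  "beta m \<xi> = (\<lambda>x y. \<xi> (m x y))"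

definition mock_pre_lie_bialgebra ::
  "('k::field \<Rightarrow> 'v::ab_group_add \<Rightarrow> 'v) \<Rightarrow> ('v \<Rightarrow> 'v \<Rightarrow> 'v) \<Rightarrow> ('k, 'v) tens2 \<Rightarrow> bool" where
  "mock_pre_lie_bialgebra sc m r \<longleftrightarrow>
     mock_pre_lie sc UNIV m \<and>
     mock_pre_lie dual_scale (dual sc) (dual_mul sc m r) \<and>
     (\<forall>x y. eq2 sc (alpha m r (acomm m x y))
        (- (map2 id (Rmul m y + Lmul m y) (alpha m r x) + map2 (Lmul m y) id (alpha m r x))
         - (map2 id (Lmul m x + Rmul m x) (alpha m r y) + map2 (Lmul m x) id (alpha m r y)))) \<and>
     (let st = dual_mul sc m r in
      \<forall>\<xi>\<in>dual sc. \<forall>\<eta>\<in>dual sc. beta m (acomm st \<xi> \<eta>) =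
        - (dual_map2 id (Rmul st \<eta> + Lmul st \<eta>) (beta m \<xi>) + dual_map2 (Lmul st \<eta>) id (beta m \<xi>))
        - (dual_map2 id (Lmul st \<xi> + Rmul st \<xi>) (beta m \<eta>) + dual_map2 (Lmul st \<xi>) id (beta m \<eta>)))"

definition quasi_triangular ::
  "('k::field \<Rightarrow> 'v::ab_group_add \<Rightarrow> 'v) \<Rightarrow> ('v \<Rightarrow> 'v \<Rightarrow> 'v) \<Rightarrow> ('k, 'v) tens2 \<Rightarrow> bool" where
  "quasi_triangular sc m r \<longleftrightarrow>
     r \<in> tensor_square sc \<and> mock_pre_lie_bialgebra sc m r \<and>
     eq3 sc (bracket sc m r) 0 \<and> L_LR_invariant sc m (skew_part r)"

definition triangular ::
  "('k::field \<Rightarrow> 'v::ab_group_add \<Rightarrow> 'v) \<Rightarrow> ('v \<Rightarrow> 'v \<Rightarrow> 'v) \<Rightarrow> ('k, 'v) tens2 \<Rightarrow> bool" where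
  "triangular sc m r \<longleftrightarrow> quasi_triangular sc m r \<and> symmetric_tensor sc r"

definition dual_linear_iso ::
  "('k::field \<Rightarrow> 'v::ab_group_add \<Rightarrow> 'v) \<Rightarrow> (('v \<Rightarrow> 'k) \<Rightarrow> 'v) \<Rightarrow> bool" where
  "dual_linear_iso sc T \<longleftrightarrow>
     (\<forall>\<xi>\<in>dual sc. \<forall>\<eta>\<in>dual sc. T (\<xi> + \<eta>) = T \<xi> + T \<eta>) \<and>
     (\<forall>c. \<forall>\<xi>\<in>dual sc. T (dual_scale c \<xi>) = sc c (T \<xi>)) \<and>
     bij_betw T (dual sc) UNIV"

definition factorizable ::
  "('k::field \<Rightarrow> 'v::ab_group_add \<Rightarrow> 'v) \<Rightarrow> ('v \<Rightarrow> 'v \<Rightarrow> 'v) \<Rightarrow> ('k, 'v) tens2 \<Rightarrow> bool" where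
  "factorizable sc m r \<longleftrightarrow> quasi_triangular sc m r \<and> dual_linear_iso sc (I_map sc r)"


subsection \<open>Well-definedness\<close>

lemma dual_add: "\<xi> \<in> dual sc \<Longrightarrow> \<xi> (x + y) = \<xi> x + \<xi> y"
  and dual_sc: "\<xi> \<in> dual sc \<Longrightarrow> \<xi> (sc c x) = c * \<xi> x"
  and dual_zero: "\<xi> \<in> dual sc \<Longrightarrow> \<xi> 0 = 0"
  and dual_minus: "\<xi> \<in> dual sc \<Longrightarrow> \<xi> (- x) = - \<xi> x"
  and dual_diff: "\<xi> \<in> dual sc \<Longrightarrow> \<xi> (x - y) = \<xi> x - \<xi> y"
  by (simp_all add: dual_def Vector_Spaces.linear.axioms(3) module_hom.add module_hom.scale
      module_hom.zero module_hom.neg module_hom.diff linear_iff_module_hom)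

lemma dual_sum: "\<xi> \<in> dual sc \<Longrightarrow> \<xi> (\<Sum>i\<in>A. f i) = (\<Sum>i\<in>A. \<xi> (f i))"
  by (induction A rule: infinite_finite_induct) (simp_all add: dual_add dual_zero)

lemma dual_sum_list: "\<xi> \<in> dual sc \<Longrightarrow> \<xi> (\<Sum>i\<leftarrow>xs. f i) = (\<Sum>i\<leftarrow>xs. \<xi> (f i))"
  by (induction xs) (simp_all add: dual_add dual_zero)

lemma dualI:
  fixes sc :: "'k::field \<Rightarrow> 'v::ab_group_add \<Rightarrow> 'v"
  assumes "vector_space sc" "\<And>x y. \<xi> (x + y) = \<xi> x + \<xi> y" "\<And>c x. \<xi> (sc c x) = c * \<xi> x"
  shows "\<xi> \<in> dual sc"
proof -
  interpret v: vector_space sc by fact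
  interpret k: vector_space "(*) :: 'k \<Rightarrow> 'k \<Rightarrow> 'k" by unfold_locales (simp_all add: algebra_simps)
  show ?thesis unfolding dual_def mem_Collect_eq
    by unfold_locales (use assms in simp_all)
qed

lemma zero_dual: "vector_space sc \<Longrightarrow> 0 \<in> dual sc"
  and add_dual: "vector_space sc \<Longrightarrow> \<xi> \<in> dual sc \<Longrightarrow> \<eta> \<in> dual sc \<Longrightarrow> \<xi> + \<eta> \<in> dual sc"
  and dual_scale_dual: "vector_space sc \<Longrightarrow> \<xi> \<in> dual sc \<Longrightarrow> dual_scale c \<xi> \<in> dual sc"
  by (rule dualI; simp add: dual_add dual_sc dual_scale_def algebra_simps)+

lemma dual_separates:
  fixes sc :: "'k::field \<Rightarrow> 'v::ab_group_add \<Rightarrow> 'v"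
  assumes "vector_space sc" "\<And>\<xi>. \<xi> \<in> dual sc \<Longrightarrow> \<xi> v = \<xi> w"
  shows "v = w"
proof (rule ccontr)
  assume "v \<noteq> w"
  interpret v: vector_space sc by fact
  interpret k: vector_space "(*) :: 'k \<Rightarrow> 'k \<Rightarrow> 'k" by unfold_locales (simp_all add: algebra_simps)
  interpret vector_space_pair sc "(*) :: 'k \<Rightarrow> 'k \<Rightarrow> 'k" by unfold_locales
  have "v.independent {v - w}" using \<open>v \<noteq> w\<close> by simp
  from linear_independent_extend[OF this, of "\<lambda>_. 1"]
  obtain g where g: "Vector_Spaces.linear sc (*) g" "g (v - w) = 1" by auto
  hence "g \<in> dual sc" by (simp add: dual_def)
  with assms(2)[OF this] g(2) show False by (simp add: dual_diff)
qed

lemma r_plus_eqI: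
  fixes sc :: "'k::field \<Rightarrow> 'v::ab_group_add \<Rightarrow> 'v"
  assumes "vector_space sc" "\<And>\<eta>. \<eta> \<in> dual sc \<Longrightarrow> \<eta> v = r \<xi> \<eta>"
  shows "r_plus sc r \<xi> = v"
  unfolding r_plus_def
proof (rule the_equality)
  fix w assume w: "\<forall>\<eta>\<in>dual sc. \<eta> w = r \<xi> \<eta>"
  show "w = v" by (rule dual_separates[OF assms(1)]) (use w assms(2) in simp)
qed (use assms(2) in simp)

lemma r_minus_eqI:
  fixes sc :: "'k::field \<Rightarrow> 'v::ab_group_add \<Rightarrow> 'v"
  assumes "vector_space sc" "\<And>\<eta>. \<eta> \<in> dual sc \<Longrightarrow> \<eta> v = r \<eta> \<xi>"
  shows "r_minus sc r \<xi> = v"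
  unfolding r_minus_def
proof (rule the_equality)
  fix w assume w: "\<forall>\<eta>\<in>dual sc. \<eta> w = r \<eta> \<xi>"
  show "w = v" by (rule dual_separates[OF assms(1)]) (use w assms(2) in simp)
qed (use assms(2) in simp)

lemma tensor_of_list_apply: "tensor_of_list ps \<xi> \<eta> = (\<Sum>(a, b)\<leftarrow>ps. \<xi> a * \<eta> b)"
  by (induction ps) (auto simp: tensor_of_list_def pure2_def)

lemma tensor_square_sum:
  fixes sc :: "'k::field \<Rightarrow> 'v::ab_group_add \<Rightarrow> 'v"
  assumes vs: "vector_space sc" and r: "r \<in> tensor_square sc" and "finite A"
    and f: "\<And>i. i \<in> A \<Longrightarrow> f i \<in> dual sc" and \<eta>: "\<eta> \<in> dual sc"
  shows "sum f A \<in> dual sc \<and> r (sum f A) \<eta> = (\<Sum>i\<in>A. r (f i) \<eta>) \<and> r \<eta> (sum f A) = (\<Sum>i\<in>A. r \<eta> (f i))"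
  using \<open>finite A\<close> f
proof (induction A)
  case empty
  have "dual_scale 0 \<eta> = 0" by (auto simp: dual_scale_def)
  moreover have "r (dual_scale 0 \<eta>) \<eta> = 0 * r \<eta> \<eta>" "r \<eta> (dual_scale 0 \<eta>) = 0 * r \<eta> \<eta>"
    using r \<eta> unfolding tensor_square_def by blast+
  ultimately show ?case using zero_dual[OF vs] by (simp add: zero_fun_def)
next
  case (insert x F)
  then have fx: "f x \<in> dual sc" and F: "sum f F \<in> dual sc"
    and IH: "r (sum f F) \<eta> = (\<Sum>i\<in>F. r (f i) \<eta>)" "r \<eta> (sum f F) = (\<Sum>i\<in>F. r \<eta> (f i))"
    by simp_all
  have "sum f (insert x F) = f x + sum f F" by (rule sum.insert) fact+
  moreover have "r (f x + sum f F) \<eta> = r (f x) \<eta> + r (sum f F) \<eta>"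
    and "r \<eta> (f x + sum f F) = r \<eta> (f x) + r \<eta> (sum f F)"
    using r fx F \<eta> unfolding tensor_square_def by blast+
  ultimately show ?case using add_dual[OF vs fx F] IH insert.hyps by (simp only: sum.insert) simp
qed

lemma tensor_decomposition:
  fixes sc :: "'k::field \<Rightarrow> 'v::ab_group_add \<Rightarrow> 'v"
  assumes fd: "finite_dimensional_vector_space sc Basis" and r: "r \<in> tensor_square sc"
  shows "\<exists>ps. eq2 sc r (tensor_of_list ps)"
proof -
  interpret finite_dimensional_vector_space sc Basis by fact
  have vs: "vector_space sc" by unfold_locales
  define e where "e b = (\<lambda>v. representation Basis v b)" for b
  have e: "e b \<in> dual sc" for b unfolding e_def
    by (rule dualI[OF vs])
      (simp_all add: representation_add representation_scale independent_Basis span_Basis)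
  have expand: "\<xi> = (\<Sum>b\<in>Basis. dual_scale (\<xi> b) (e b))" if "\<xi> \<in> dual sc" for \<xi>
  proof
    fix v
    have "\<xi> v = \<xi> (\<Sum>b\<in>Basis. sc (representation Basis v b) b)"
      by (subst sum_representation_eq) (simp_all add: independent_Basis span_Basis finite_Basis)
    also have "\<dots> = (\<Sum>b\<in>Basis. representation Basis v b * \<xi> b)"
      using that by (simp add: dual_sum dual_sc)
    also have "\<dots> = (\<Sum>b\<in>Basis. dual_scale (\<xi> b) (e b)) v"
    proof -
      have "(\<Sum>b\<in>A. dual_scale (\<xi> b) (e b)) v = (\<Sum>b\<in>A. representation Basis v b * \<xi> b)"
        if "finite A" for A
        using that by induction (simp_all add: dual_scale_def e_def mult.commute)
      then show ?thesis using finite_Basis by simp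
    qed
    finally show "\<xi> v = (\<Sum>b\<in>Basis. dual_scale (\<xi> b) (e b)) v" .
  qed
  obtain bs where bs: "set bs = Basis" "distinct bs"
    using finite_distinct_list[OF finite_Basis] by blast
  define g where "g b = (\<Sum>c\<in>Basis. sc (r (e b) (e c)) c)" for b
  have "r \<xi> \<eta> = tensor_of_list (map (\<lambda>b. (b, g b)) bs) \<xi> \<eta>"
    if \<xi>: "\<xi> \<in> dual sc" and \<eta>: "\<eta> \<in> dual sc" for \<xi> \<eta>
  proof -
    have scl: "r (dual_scale c x) y = c * r x y" "r x (dual_scale c y) = c * r x y"
      if "x \<in> dual sc" "y \<in> dual sc" for c x y
      using r that unfolding tensor_square_def by blast+
    have "r \<xi> \<eta> = r (\<Sum>b\<in>Basis. dual_scale (\<xi> b) (e b)) \<eta>" using expand[OF \<xi>] by simp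
    also have "\<dots> = (\<Sum>b\<in>Basis. \<xi> b * r (e b) \<eta>)"
      using tensor_square_sum[OF vs r finite_Basis dual_scale_dual[OF vs e] \<eta>]
      by (simp add: scl e \<eta>)
    also have "\<dots> = (\<Sum>b\<in>Basis. \<xi> b * \<eta> (g b))"
    proof (rule sum.cong[OF refl])
      fix b
      have "r (e b) \<eta> = r (e b) (\<Sum>c\<in>Basis. dual_scale (\<eta> c) (e c))" using expand[OF \<eta>] by simp
      also have "\<dots> = (\<Sum>c\<in>Basis. \<eta> c * r (e b) (e c))"
        using tensor_square_sum[OF vs r finite_Basis dual_scale_dual[OF vs e] e]
        by (simp add: scl e)
      also have "\<dots> = \<eta> (g b)"
        unfolding g_def using \<eta> by (simp add: dual_sum dual_sc mult.commute)
      finally show "\<xi> b * r (e b) \<eta> = \<xi> b * \<eta> (g b)" by simp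
    qed
    also have "\<dots> = (\<Sum>b\<leftarrow>bs. \<xi> b * \<eta> (g b))"
      using bs by (simp add: sum_list_distinct_conv_sum_set)
    finally show ?thesis by (simp add: tensor_of_list_apply o_def)
  qed
  then show ?thesis unfolding eq2_def by blast
qed

lemma bracket_of_list_apply:
  fixes sc :: "'k::field \<Rightarrow> 'v::ab_group_add \<Rightarrow> 'v"
  assumes vs: "vector_space sc" and m: "bilinear_product sc UNIV m"
    and rep: "eq2 sc r (tensor_of_list ps)"
    and d: "\<xi> \<in> dual sc" "\<eta> \<in> dual sc" "\<zeta> \<in> dual sc"
  shows "bracket_of_list m ps \<xi> \<eta> \<zeta> =
      - \<xi> (m (r_minus sc r \<zeta>) (r_minus sc r \<eta>)) - \<eta> (m (r_minus sc r \<zeta>) (r_minus sc r \<xi>))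
      + \<eta> (acomm m (r_minus sc r \<zeta>) (r_plus sc r \<xi>)) + \<xi> (acomm m (r_minus sc r \<zeta>) (r_plus sc r \<eta>))
      - \<zeta> (acomm m (r_plus sc r \<xi>) (r_plus sc r \<eta>))"
proof -
  interpret vector_space sc by fact
  have madd: "m (x + y) z = m x z + m y z" "m z (x + y) = m z x + m z y"
    and msc: "m (sc c x) y = sc c (m x y)" "m x (sc c y) = sc c (m x y)" for x y z c
    using m by (auto simp: bilinear_product_def)
  have m0: "m 0 y = 0" "m y 0 = 0" for y
    using msc(1)[of 0 0 y] msc(2)[of y 0 0] by simp_all
  have P: "r_plus sc r \<alpha> = (\<Sum>(a, b)\<leftarrow>ps. sc (\<alpha> a) b)" if "\<alpha> \<in> dual sc" for \<alpha>
  proof (rule r_plus_eqI[OF vs])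
    fix \<beta> assume b: "\<beta> \<in> dual sc"
    show "\<beta> (\<Sum>(a, b)\<leftarrow>ps. sc (\<alpha> a) b) = r \<alpha> \<beta>"
      using rep that b by (simp add: eq2_def tensor_of_list_apply dual_sum_list split_def dual_sc)
  qed
  have M: "r_minus sc r \<alpha> = (\<Sum>(a, b)\<leftarrow>ps. sc (\<alpha> b) a)" if "\<alpha> \<in> dual sc" for \<alpha>
  proof (rule r_minus_eqI[OF vs])
    fix \<beta> assume b: "\<beta> \<in> dual sc"
    show "\<beta> (\<Sum>(a, b)\<leftarrow>ps. sc (\<alpha> b) a) = r \<beta> \<alpha>"
      using rep that b
      by (simp add: eq2_def tensor_of_list_apply dual_sum_list split_def dual_sc mult.commute)
  qed
  have ml: "m (\<Sum>i\<leftarrow>xs. f i) y = (\<Sum>i\<leftarrow>xs. m (f i) y)"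
    and mr: "m y (\<Sum>i\<leftarrow>xs. f i) = (\<Sum>i\<leftarrow>xs. m y (f i))"
    for y and f :: "'v \<times> 'v \<Rightarrow> 'v" and xs
    by (induction xs) (simp_all add: m0 madd)
  have cmul: "c * (\<Sum>i\<leftarrow>xs. f i) = (\<Sum>i\<leftarrow>xs. c * f i)" for c :: 'k and f :: "'v \<times> 'v \<Rightarrow> 'k" and xs
    by (rule sum_list_const_mult[symmetric])
  have swap: "(\<Sum>p\<leftarrow>ps. \<Sum>q\<leftarrow>ps. h p q) = (\<Sum>q\<leftarrow>ps. \<Sum>p\<leftarrow>ps. h p q)"
    for h :: "'v \<times> 'v \<Rightarrow> 'v \<times> 'v \<Rightarrow> 'k"
  proof -
    have "(\<Sum>p\<leftarrow>xs. \<Sum>q\<leftarrow>ys. h p q) = (\<Sum>q\<leftarrow>ys. \<Sum>p\<leftarrow>xs. h p q)" for xs ys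
      by (induction xs) (simp_all add: sum_list_addf)
    then show ?thesis .
  qed
  have key: "\<alpha> (m (\<Sum>p\<leftarrow>ps. sc (f p) (u p)) (\<Sum>p\<leftarrow>ps. sc (g p) (v p)))
      = (\<Sum>p\<leftarrow>ps. \<Sum>q\<leftarrow>ps. f p * g q * \<alpha> (m (u p) (v q)))"
    if "\<alpha> \<in> dual sc" for \<alpha> f g u v
    using that by (subst swap) (simp add: ml mr msc dual_sum_list dual_sc cmul mult_ac)
  have app3: "(\<Sum>p\<leftarrow>xs. F p) \<xi> \<eta> \<zeta> = (\<Sum>p\<leftarrow>xs. F p \<xi> \<eta> \<zeta>)" for F :: "'v \<times> 'v \<Rightarrow> ('k, 'v) tens3" and xs
    by (induction xs) simp_all
  have sadd: "(\<Sum>p\<leftarrow>ps. \<Sum>q\<leftarrow>ps. F p q + G p q) = (\<Sum>p\<leftarrow>ps. \<Sum>q\<leftarrow>ps. F p q) + (\<Sum>p\<leftarrow>ps. \<Sum>q\<leftarrow>ps. G p q)"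
    for F G :: "'v \<times> 'v \<Rightarrow> 'v \<times> 'v \<Rightarrow> 'k"
    by (simp add: sum_list_addf)
  have sneg: "(\<Sum>p\<leftarrow>ps. \<Sum>q\<leftarrow>ps. - F p q) = - (\<Sum>p\<leftarrow>ps. \<Sum>q\<leftarrow>ps. F p q)"
    for F :: "'v \<times> 'v \<Rightarrow> 'v \<times> 'v \<Rightarrow> 'k"
    by (simp add: uminus_sum_list_map o_def)
  define T where "T f g \<alpha> u v = (\<Sum>p\<leftarrow>ps. \<Sum>q\<leftarrow>ps. f p * g q * \<alpha> (m (u p) (v q)))"
    for f g :: "'v \<times> 'v \<Rightarrow> 'k" and \<alpha> and u v :: "'v \<times> 'v \<Rightarrow> 'v"
  have "bracket_of_list m ps \<xi> \<eta> \<zeta> = (\<Sum>p\<leftarrow>ps. \<Sum>q\<leftarrow>ps.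
      - (\<zeta> (snd p) * \<eta> (snd q) * \<xi> (m (fst p) (fst q)))
      + - (\<zeta> (snd p) * \<xi> (snd q) * \<eta> (m (fst p) (fst q)))
      + \<zeta> (snd p) * \<xi> (fst q) * \<eta> (m (fst p) (snd q))
      + \<zeta> (snd p) * \<xi> (fst q) * \<eta> (m (snd q) (fst p))
      + \<zeta> (snd p) * \<eta> (fst q) * \<xi> (m (fst p) (snd q))
      + \<zeta> (snd p) * \<eta> (fst q) * \<xi> (m (snd q) (fst p))
      + - (\<xi> (fst p) * \<eta> (fst q) * \<zeta> (m (snd p) (snd q)))
      + - (\<xi> (fst p) * \<eta> (fst q) * \<zeta> (m (snd q) (snd p))))"
    unfolding bracket_of_list_def split_def app3 using d
    by (intro arg_cong[where f = sum_list] map_cong refl)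
      (simp add: pure3_def acomm_def dual_add algebra_simps)
  also have "\<dots> = - T (\<zeta> \<circ> snd) (\<eta> \<circ> snd) \<xi> fst fst - T (\<zeta> \<circ> snd) (\<xi> \<circ> snd) \<eta> fst fst
      + T (\<zeta> \<circ> snd) (\<xi> \<circ> fst) \<eta> fst snd + T (\<xi> \<circ> fst) (\<zeta> \<circ> snd) \<eta> snd fst
      + T (\<zeta> \<circ> snd) (\<eta> \<circ> fst) \<xi> fst snd + T (\<eta> \<circ> fst) (\<zeta> \<circ> snd) \<xi> snd fst
      - T (\<xi> \<circ> fst) (\<eta> \<circ> fst) \<zeta> snd snd - T (\<eta> \<circ> fst) (\<xi> \<circ> fst) \<zeta> snd snd"
  proof -
    have sw: "T f g \<alpha> u v = (\<Sum>p\<leftarrow>ps. \<Sum>q\<leftarrow>ps. g p * f q * \<alpha> (m (u q) (v p)))" for f g \<alpha> u v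
      unfolding T_def by (subst swap) (simp add: mult.commute)
    show ?thesis
      unfolding sadd sneg
      by (simp add: T_def[of "\<zeta> \<circ> snd"] T_def[of "\<xi> \<circ> fst" "\<eta> \<circ> fst"]
          sw[of _ "\<zeta> \<circ> snd"] sw[of "\<eta> \<circ> fst" "\<xi> \<circ> fst"])
  qed
  also have "\<dots> = - \<xi> (m (r_minus sc r \<zeta>) (r_minus sc r \<eta>)) - \<eta> (m (r_minus sc r \<zeta>) (r_minus sc r \<xi>))
      + \<eta> (acomm m (r_minus sc r \<zeta>) (r_plus sc r \<xi>)) + \<xi> (acomm m (r_minus sc r \<zeta>) (r_plus sc r \<eta>))
      - \<zeta> (acomm m (r_plus sc r \<xi>) (r_plus sc r \<eta>))"
    using d by (simp add: P M acomm_def dual_add split_def key[OF d(1)] key[OF d(2)] key[OF d(3)] T_def algebra_simps)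
  finally show ?thesis .
qed

lemma bracket_eq:
  fixes sc :: "'k::field \<Rightarrow> 'v::ab_group_add \<Rightarrow> 'v"
  assumes "vector_space sc" "bilinear_product sc UNIV m" "eq2 sc r (tensor_of_list ps)"
  shows "eq3 sc (bracket sc m r) (bracket_of_list m ps)"
proof -
  have "eq2 sc r (tensor_of_list (SOME ps. eq2 sc r (tensor_of_list ps)))"
    using assms(3) by (rule someI)
  from bracket_of_list_apply[OF assms(1,2) this] bracket_of_list_apply[OF assms]
  show ?thesis by (simp add: eq3_def bracket_def)
qed

text \<open>\<open>dual_mul\<close> is the product dual to \<open>alpha\<close>.\<close>

lemma dual_mul_alpha:
  fixes sc :: "'k::field \<Rightarrow> 'v::ab_group_add \<Rightarrow> 'v"
  assumes fd: "finite_dimensional_vector_space sc Basis" and m: "bilinear_product sc UNIV m"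
    and r: "r \<in> tensor_square sc" and d: "\<xi> \<in> dual sc" "\<eta> \<in> dual sc"
  shows "dual_mul sc m r \<xi> \<eta> x = alpha m r x \<xi> \<eta>"
proof -
  interpret finite_dimensional_vector_space sc Basis by fact
  have vs: "vector_space sc" by unfold_locales
  obtain ps where ps: "eq2 sc r (tensor_of_list ps)" using tensor_decomposition[OF fd r] by blast
  have P: "\<beta> (r_plus sc r \<alpha>) = r \<alpha> \<beta>" if "\<alpha> \<in> dual sc" "\<beta> \<in> dual sc" for \<alpha> \<beta>
  proof -
    have "r_plus sc r \<alpha> = (\<Sum>(a, b)\<leftarrow>ps. sc (\<alpha> a) b)"
      using ps that
      by (intro r_plus_eqI[OF vs]) (simp add: eq2_def tensor_of_list_apply dual_sum_list split_def dual_sc)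
    then show ?thesis
      using ps that by (simp add: eq2_def tensor_of_list_apply dual_sum_list split_def dual_sc)
  qed
  have M: "\<beta> (r_minus sc r \<alpha>) = r \<beta> \<alpha>" if "\<alpha> \<in> dual sc" "\<beta> \<in> dual sc" for \<alpha> \<beta>
  proof -
    have "r_minus sc r \<alpha> = (\<Sum>(a, b)\<leftarrow>ps. sc (\<alpha> b) a)"
      using ps that
      by (intro r_minus_eqI[OF vs])
        (simp add: eq2_def tensor_of_list_apply dual_sum_list split_def dual_sc mult.commute)
    then show ?thesis
      using ps that
      by (simp add: eq2_def tensor_of_list_apply dual_sum_list split_def dual_sc mult.commute)
  qed
  have LR: "\<alpha> \<circ> Lmul m x \<in> dual sc" "\<alpha> \<circ> Rmul m x \<in> dual sc" if "\<alpha> \<in> dual sc" for \<alpha>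
    using m that
    by (auto intro!: dualI[OF vs] simp: bilinear_product_def Lmul_def Rmul_def dual_add dual_sc)
  show ?thesis
    using P[OF d(1) LR(1)[OF d(2)]] P[OF d(1) LR(2)[OF d(2)]] M[OF d(2) LR(1)[OF d(1)]]
    by (simp add: dual_mul_def alpha_def map2_def Lstar_def Rstar_def Lmul_def Rmul_def)
qed

end

theory Submission
  imports Defs
begin

text \<open>
  Identify the dual with the algebra through \<open>a \<mapsto> \<omega>(a, \<cdot>)\<close> and put \<open>Q = B + \<lambda>\<close>.  Under this
  identification \<open>r\<^sub>+ = B\<close> and \<open>r\<^sub>- = Q\<close> (which is minus the \<open>\<omega>\<close>-adjoint of \<open>B\<close>), so \<open>I = -\<lambda>\<close>, and
  the product on the dual becomes the descendant product \<open>a \<circ> b = B a \<cdot> b + a \<cdot> Q b\<close>, for which both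
  \<open>B\<close> and \<open>Q\<close> are multiplicative.  The transposes of \<open>L\<^sub>x\<close>, \<open>L\<^sub>x + R\<^sub>x\<close> and \<open>R\<^sub>x\<close> become \<open>{x, \<cdot>}\<close>,
  \<open>L\<^sub>x\<close> and \<open>-R\<^sub>x\<close>, and every condition turns into an identity in the algebra itself.
\<close>

section \<open>The dual space as the range of a nondegenerate form\<close>

lemma (in finite_dimensional_vector_space) nondegenerate_skew_form_range:
  assumes nd: "nondegenerate_skew_form scale \<omega>"
  shows "range \<omega> = dual scale"
proof
  have lin: "\<omega> x \<in> dual scale" "(\<lambda>u. \<omega> u x) \<in> dual scale" for x
    using nd unfolding nondegenerate_skew_form_def dual_def by blast+
  then show "range \<omega> \<subseteq> dual scale" by blast
  have agree: "\<xi> = \<zeta>" if d: "\<xi> \<in> dual scale" "\<zeta> \<in> dual scale" and eq: "\<And>b. b \<in> Basis \<Longrightarrow> \<xi> b = \<zeta> b"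
    for \<xi> \<zeta>
  proof
    fix v
    have "v = (\<Sum>b\<in>Basis. scale (representation Basis v b) b)"
      by (subst sum_representation_eq) (simp_all add: independent_Basis span_Basis finite_Basis)
    then obtain c where v: "v = (\<Sum>b\<in>Basis. scale (c b) b)" by blast
    show "\<xi> v = \<zeta> v" unfolding v using d eq by (simp add: dual_sum dual_sc)
  qed
  \<comment> \<open>\<open>\<Phi> x\<close> encodes the functional \<open>\<omega> x\<close> by its
    values on \<open>Basis\<close>, read as coordinates. This turns \<open>\<omega>\<close> into an
    endomorphism, for which injectivity (nondegeneracy) gives surjectivity by finite
    dimension.\<close>
  define \<Phi> where "\<Phi> x = (\<Sum>b\<in>Basis. scale (\<omega> x b) b)" for x
  have "Vector_Spaces.linear scale scale \<Phi>"
    by unfold_locales (simp_all add: \<Phi>_def dual_add[OF lin(2)] dual_sc[OF lin(2)] scale_left_distrib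
        sum.distrib scale_sum_right)
  have coeff: "c b = d b" if "(\<Sum>b\<in>Basis. scale (c b) b) = (\<Sum>b\<in>Basis. scale (d b) b)" "b \<in> Basis" for c d b
  proof -
    have "(\<Sum>b\<in>Basis. scale (c b - d b) b) = 0"
      using that(1) by (simp add: scale_left_diff_distrib sum_subtractf)
    then show ?thesis
      using independentD[OF independent_Basis finite_Basis subset_refl _ that(2), of "\<lambda>b. c b - d b"]
      by simp
  qed
  have "inj \<Phi>"
  proof (rule injI)
    fix x y assume "\<Phi> x = \<Phi> y"
    then have "\<omega> x = \<omega> y"
      by (intro agree lin coeff) (simp_all add: \<Phi>_def)
    then have "\<omega> (x - y) z = 0" for z by (simp add: dual_diff[OF lin(2)])
    then have "x - y = 0" using nd unfolding nondegenerate_skew_form_def by blast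
    then show "x = y" by simp
  qed
  with \<open>Vector_Spaces.linear scale scale \<Phi>\<close> have "surj \<Phi>" by (rule linear_inj_imp_surj)
  show "dual scale \<subseteq> range \<omega>"
  proof
    fix \<xi> assume \<xi>: "\<xi> \<in> dual scale"
    obtain x where "\<Phi> x = (\<Sum>b\<in>Basis. scale (\<xi> b) b)" using \<open>surj \<Phi>\<close> by (metis surjD)
    then have "\<xi> = \<omega> x" by (intro agree \<xi> lin coeff) (simp_all add: \<Phi>_def)
    then show "\<xi> \<in> range \<omega>" by simp
  qed
qed

section \<open>Quadratic Rota-Baxter algebras: linearity rules and the identification with the
  dual\<close>

locale quadratic_rota_baxter_algebra = finite_dimensional_vector_space sc Basis
  for sc :: "'k::field_char_0 \<Rightarrow> 'v::ab_group_add \<Rightarrow> 'v" and Basis :: "'v set" +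
  fixes m :: "'v \<Rightarrow> 'v \<Rightarrow> 'v" and l :: 'k and B :: "'v \<Rightarrow> 'v" and \<omega> :: "'v \<Rightarrow> 'v \<Rightarrow> 'k"
  assumes quadratic: "quadratic_rota_baxter sc m l B \<omega>"
begin

definition Q :: "'v \<Rightarrow> 'v" where "Q x = B x + sc l x"

definition desc :: "'v \<Rightarrow> 'v \<Rightarrow> 'v" where "desc a b = m (B a) b + m a (Q b)"

abbreviation r :: "('k, 'v) tens2" where "r \<equiv> tensor_of_map (B \<circ> form_iso \<omega>)"

lemma vs: "vector_space sc" by unfold_locales

lemma bilinear: "bilinear_product sc UNIV m"
  and mock: "m (m x y) z + m x (m y z) + m (m y x) z + m y (m x z) = 0"
  using quadratic by (simp_all add: quadratic_rota_baxter_def mock_pre_lie_def)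

lemma m_add: "m (x + y) z = m x z + m y z" "m z (x + y) = m z x + m z y"
  and m_sc: "m (sc c x) y = sc c (m x y)" "m x (sc c y) = sc c (m x y)"
  using bilinear by (simp_all add: bilinear_product_def)

lemma B_add: "B (x + y) = B x + B y"
  and B_sc: "B (sc c x) = sc c (B x)"
proof -
  have "Vector_Spaces.linear sc sc B"
    using quadratic by (simp add: quadratic_rota_baxter_def rota_baxter_def)
  then interpret Vector_Spaces.linear sc sc B .
  show "B (x + y) = B x + B y" "B (sc c x) = sc c (B x)" by (rule add, rule scale)
qed

lemma nondegenerate: "nondegenerate_skew_form sc \<omega>"
  using quadratic by (simp add: quadratic_rota_baxter_def)

lemma form_dual: "\<omega> x \<in> dual sc" "(\<lambda>u. \<omega> u x) \<in> dual sc"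
  using nondegenerate unfolding nondegenerate_skew_form_def dual_def by blast+

lemmas form_add = dual_add[OF form_dual(1)] dual_add[OF form_dual(2)]
lemmas form_diff = dual_diff[OF form_dual(1)] dual_diff[OF form_dual(2)]
lemmas form_minus = dual_minus[OF form_dual(1)] dual_minus[OF form_dual(2)]
lemmas form_sc = dual_sc[OF form_dual(1)] dual_sc[OF form_dual(2)]
lemmas form_zero = dual_zero[OF form_dual(1)] dual_zero[OF form_dual(2)]

lemma form_skew: "\<omega> x y = - \<omega> y x"
  using nondegenerate unfolding nondegenerate_skew_form_def by blast

lemma form_inj: "inj \<omega>"
proof (rule injI)
  fix x y assume "\<omega> x = \<omega> y"
  then have "\<omega> (x - y) z = 0" for z by (simp add: form_diff)
  then have "x - y = 0" using nondegenerate unfolding nondegenerate_skew_form_def by blast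
  then show "x = y" by simp
qed

lemma form_iso_form [simp]: "form_iso \<omega> (\<omega> a) = a"
  by (simp add: form_iso_def form_inj)

lemma dual_eq: "dual sc = range \<omega>"
  by (rule nondegenerate_skew_form_range[OF nondegenerate, symmetric])

lemma form_vector_ops: "\<omega> a + \<omega> b = \<omega> (a + b)" "dual_scale c (\<omega> a) = \<omega> (sc c a)"
  by (auto simp: form_add form_sc dual_scale_def)

section \<open>Adjoints with respect to the form\<close>

lemma form_left: "\<omega> (m x y) z = \<omega> y (acomm m x z)"
  using quadratic by (simp add: quadratic_rota_baxter_def)

lemma form_mult: "\<omega> a (m x y) = \<omega> (acomm m x a) y"
  using form_left[of x y a] by (metis form_skew)

lemma form_acomm: "\<omega> a (acomm m x y) = \<omega> (m x a) y"
  by (simp add: form_left)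

text \<open>Right multiplication by \<open>x\<close> is \<open>{x, \<cdot>}\<close> minus left
  multiplication. Their transposes are \<open>m x\<close> and \<open>acomm m x\<close>, which differ
  by minus right multiplication.\<close>

lemma form_right: "\<omega> a (m y x) = - \<omega> (m a x) y"
proof -
  have "\<omega> a (m y x) = \<omega> a (acomm m x y) - \<omega> a (m x y)" by (simp add: acomm_def form_add)
  then show ?thesis unfolding form_acomm form_mult by (simp add: acomm_def form_add)
qed

lemma form_transpose:
  "\<omega> a \<circ> Lmul m x = \<omega> (acomm m x a)"
  "\<omega> a \<circ> (Lmul m x + Rmul m x) = \<omega> (m x a)"
  "\<omega> a \<circ> (Rmul m x + Lmul m x) = \<omega> (m x a)"
proof -
  show "\<omega> a \<circ> Lmul m x = \<omega> (acomm m x a)" by (auto simp: Lmul_def form_mult)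
  have "Lmul m x + Rmul m x = acomm m x" "Rmul m x + Lmul m x = acomm m x"
    by (auto simp: Lmul_def Rmul_def acomm_def add.commute)
  then show "\<omega> a \<circ> (Lmul m x + Rmul m x) = \<omega> (m x a)" "\<omega> a \<circ> (Rmul m x + Lmul m x) = \<omega> (m x a)"
    by (auto simp: form_acomm)
qed

lemma form_B: "\<omega> (B x) y = - \<omega> x (Q y)"
proof -
  have "\<omega> (B x) y + \<omega> x (B y) + l * \<omega> x y = 0"
    using quadratic by (simp add: quadratic_rota_baxter_def)
  then show ?thesis unfolding eq_neg_iff_add_eq_0 by (simp add: Q_def form_add form_sc add.assoc)
qed

lemma form_Q: "\<omega> (Q x) y = - \<omega> x (B y)"
  by (metis form_B form_skew)

text \<open>Both sides are \<open>\<omega> b\<close> paired with the same anticommutator, up to its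
  symmetry in \<open>y\<close> and \<open>z\<close>.\<close>

lemma form_swap: "\<omega> (m y b) z = \<omega> (m z b) y"
  by (simp add: form_left acomm_def add.commute)

section \<open>The descendant product\<close>

lemma Q_add: "Q (x + y) = Q x + Q y"
  and Q_sc: "Q (sc c x) = sc c (Q x)"
  by (simp_all add: Q_def B_add B_sc scale_right_distrib mult.commute)

text \<open>The weight term \<open>sc l (m a b)\<close> can be absorbed into either factor, so
  \<open>B\<close> and \<open>Q\<close> may trade places.\<close>

lemma desc_eq: "desc a b = m (Q a) b + m a (B b)"
  by (simp add: desc_def Q_def m_add m_sc)

lemma B_desc: "B (desc a b) = m (B a) (B b)"
  using quadratic
  by (simp add: quadratic_rota_baxter_def rota_baxter_def desc_def Q_def m_add m_sc add.assoc)

lemma Q_desc: "Q (desc a b) = m (Q a) (Q b)"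
  by (simp add: Q_def[of "desc a b"] B_desc) (simp add: desc_def Q_def m_add m_sc scale_right_distrib algebra_simps)

lemma desc_add: "desc (x + y) z = desc x z + desc y z" "desc z (x + y) = desc z x + desc z y"
  and desc_sc: "desc (sc c x) y = sc c (desc x y)" "desc x (sc c y) = sc c (desc x y)"
  by (simp_all add: desc_def m_add m_sc B_add B_sc Q_add Q_sc scale_right_distrib algebra_simps)

lemma desc_mock: "desc (desc a b) c + desc a (desc b c) + desc (desc b a) c + desc b (desc a c) = 0"
proof -
  have "desc (desc a b) c + desc a (desc b c) + desc (desc b a) c + desc b (desc a c)
    = (m (m (B a) (B b)) c + m (B a) (m (B b) c) + m (m (B b) (B a)) c + m (B b) (m (B a) c))
    + (m (m (B a) b) (Q c) + m (B a) (m b (Q c)) + m (m b (B a)) (Q c) + m b (m (B a) (Q c)))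
    + (m (m a (Q b)) (Q c) + m a (m (Q b) (Q c)) + m (m (Q b) a) (Q c) + m (Q b) (m a (Q c)))"
    \<comment> \<open>Only the outer products are opened first, so that \<open>B_desc\<close> and
      \<open>Q_desc\<close> remove every operator applied to a product. What remains is the
      mock-pre-Lie identity at \<open>(B a, B b, c)\<close>, \<open>(B a, b, Q c)\<close> and
      \<open>(a, Q b, Q c)\<close>.\<close>
    unfolding desc_def[of "desc a b"] desc_def[of "desc b a"] desc_def[of a "desc b c"]
      desc_def[of b "desc a c"] B_desc Q_desc
    by (simp add: desc_def Q_def m_add m_sc scale_right_distrib algebra_simps)
  also have "\<dots> = 0" unfolding mock by simp
  finally show ?thesis .
qed

text \<open>The sum of the mock-pre-Lie identity over the cyclic permutations of \<open>x\<close>,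
  \<open>y\<close>, \<open>z\<close>; the anticommutator is thus a mock-Lie product.\<close>

lemma acomm_jacobi: "acomm m x (acomm m y z) + acomm m y (acomm m z x) + acomm m z (acomm m x y) = 0"
proof -
  have "acomm m x (acomm m y z) + acomm m y (acomm m z x) + acomm m z (acomm m x y)
    = (m (m x y) z + m x (m y z) + m (m y x) z + m y (m x z))
    + (m (m y z) x + m y (m z x) + m (m z y) x + m z (m y x))
    + (m (m z x) y + m z (m x y) + m (m x z) y + m x (m z y))"
    by (simp add: acomm_def m_add algebra_simps)
  then show ?thesis unfolding mock by simp
qed

lemma acomm_commute: "acomm m x y = acomm m y x"
  by (simp add: acomm_def add.commute)

lemma acomm_add: "acomm m (x + y) z = acomm m x z + acomm m y z" "acomm m z (x + y) = acomm m z x + acomm m z y"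
  and acomm_sc: "acomm m x (sc c y) = sc c (acomm m x y)"
  by (simp_all add: acomm_def m_add m_sc scale_right_distrib algebra_simps)

section \<open>The tensor \<open>r\<close>, its maps and the dual product, seen in the
  algebra\<close>

lemma r_form: "r (\<omega> a) (\<omega> b) = \<omega> b (B a)"
  by (simp add: tensor_of_map_def)

lemma r_tensor: "r \<in> tensor_square sc"
  unfolding tensor_square_def dual_eq
  by (auto simp: form_vector_ops r_form) (auto simp: form_add form_sc B_add B_sc)

lemma r_plus_form: "r_plus sc r (\<omega> a) = B a"
  by (rule r_plus_eqI[OF vs]) (simp add: tensor_of_map_def)

text \<open>Exchanging the arguments of \<open>r\<close> replaces \<open>B\<close> by minus its
  adjoint for the skew form, which is \<open>Q\<close> by \<open>form_B\<close>.\<close>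

lemma r_minus_form: "r_minus sc r (\<omega> a) = Q a"
proof (rule r_minus_eqI[OF vs])
  fix \<eta> assume "\<eta> \<in> dual sc"
  then obtain b where "\<eta> = \<omega> b" by (auto simp: dual_eq)
  then show "\<eta> (Q a) = r \<eta> (\<omega> a)" using form_B[of b a] form_skew[of a "B b"] by (simp add: r_form)
qed

lemma I_map_form: "I_map sc r (\<omega> a) = sc (- l) a"
  by (simp add: I_map_def r_plus_form r_minus_form Q_def)

lemma dual_mul_form: "dual_mul sc m r (\<omega> a) (\<omega> b) = \<omega> (desc a b)"
proof
  fix y
  show "dual_mul sc m r (\<omega> a) (\<omega> b) y = \<omega> (desc a b) y"
    unfolding dual_mul_def r_plus_form r_minus_form desc_def
    using form_acomm[of b "B a" y]
    by (simp add: Lstar_def Rstar_def form_right form_add acomm_def)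
qed

lemma acomm_dual_mul_form: "acomm (dual_mul sc m r) (\<omega> a) (\<omega> b) = \<omega> (acomm desc a b)"
  by (simp add: acomm_def dual_mul_form form_vector_ops)

lemma dual_mul_mock_pre_lie: "mock_pre_lie dual_scale (dual sc) (dual_mul sc m r)"
proof -
  have "bilinear_product dual_scale (dual sc) (dual_mul sc m r)"
    unfolding bilinear_product_def dual_eq
    by (auto simp: form_vector_ops dual_mul_form desc_add desc_sc)
  moreover have "\<omega> (desc (desc a b) c) + \<omega> (desc a (desc b c))
      = - \<omega> (desc (desc b a) c) - \<omega> (desc b (desc a c))" for a b c
  proof
    fix y
    have "\<omega> (desc (desc a b) c + desc a (desc b c) + desc (desc b a) c + desc b (desc a c)) y = 0"
      by (simp only: desc_mock form_zero)
    then show "(\<omega> (desc (desc a b) c) + \<omega> (desc a (desc b c))) y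
      = (- \<omega> (desc (desc b a) c) - \<omega> (desc b (desc a c))) y"
      unfolding form_add plus_fun_apply minus_apply uminus_apply by algebra
  qed
  ultimately show ?thesis unfolding mock_pre_lie_def dual_eq by (auto simp: dual_mul_form)
qed

section \<open>The two bialgebra compatibility conditions\<close>

lemma alpha_form: "alpha m r x (\<omega> a) (\<omega> b) = \<omega> (desc a b) x"
  using dual_mul_alpha[OF finite_dimensional_vector_space_axioms bilinear r_tensor form_dual(1) form_dual(1)]
  by (simp add: dual_mul_form)

text \<open>This is the condition on \<open>alpha\<close> evaluated at \<open>\<omega> a\<close>,
  \<open>\<omega> b\<close>. Moving \<open>y\<close> to the second slot of the form in every term
  makes those with \<open>B\<close> of an anticommutator or \<open>Q\<close> of a product
  cancel.\<close>

lemma alpha_identity: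
  "\<omega> (desc a b) (acomm m x y) =
    - (\<omega> (desc a (m y b)) x + \<omega> (desc (acomm m y a) b) x)
    - (\<omega> (desc a (m x b)) y + \<omega> (desc (acomm m x a) b) y)"
proof -
  have 1: "\<omega> (m (B a) (m y b)) x = \<omega> (m (acomm m (B a) x) b) y"
    by (simp add: form_left[of "B a"] form_swap[of y b])
  have 2: "\<omega> (m a (Q (m y b))) x = - \<omega> (m (B (acomm m a x)) b) y"
    by (simp add: form_left[of a] form_Q form_swap[of y b])
  have 3: "\<omega> (m (B (acomm m y a)) b) x = - \<omega> (m a (Q (m x b))) y"
    by (simp add: form_swap[of "B _" b] form_left[of a] form_Q acomm_commute[of a])
  have 4: "\<omega> (m (acomm m y a) (Q b)) x = \<omega> (m a (m x (Q b))) y"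
    by (simp add: form_swap[of "acomm m y a"] form_left[of a] acomm_commute[of a])
  have 5: "\<omega> (desc a b) (acomm m x y) = \<omega> (m x (desc a b)) y" by (simp add: form_acomm)
  \<comment> \<open>The surviving terms are the mock-pre-Lie identity at \<open>(x, B a, b)\<close>
    and at \<open>(x, a, Q b)\<close>, paired with \<open>y\<close>.\<close>
  have "\<omega> ((m (m x (B a)) b + m x (m (B a) b) + m (m (B a) x) b + m (B a) (m x b))
      + (m (m x a) (Q b) + m x (m a (Q b)) + m (m a x) (Q b) + m a (m x (Q b)))) y = 0"
    unfolding mock by (simp add: form_zero)
  then show ?thesis
    unfolding 5 desc_def[of a "m y b"] desc_def[of "acomm m y a"] form_add 1 2 3 4
      acomm_commute[of a x]
    unfolding desc_def form_add m_add acomm_def B_add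
    by algebra
qed

lemma alpha_cocycle:
  "eq2 sc (alpha m r (acomm m x y))
    (- (map2 id (Rmul m y + Lmul m y) (alpha m r x) + map2 (Lmul m y) id (alpha m r x))
     - (map2 id (Lmul m x + Rmul m x) (alpha m r y) + map2 (Lmul m x) id (alpha m r y)))"
  unfolding eq2_def dual_eq
  by (auto simp: map2_def form_transpose alpha_form alpha_identity)

text \<open>This is the condition on \<open>beta\<close> evaluated at \<open>x\<close>,
  \<open>y\<close>. With \<open>y\<close> moved to the second slot, only nested anticommutators
  occur, so the mock-Lie Jacobi identity suffices.\<close>

lemma beta_identity:
  "\<omega> (acomm desc a b) (m x y) =
    - (\<omega> (acomm desc b (acomm m x a)) y - \<omega> (desc b (m a y)) x)
    - (\<omega> (acomm desc a (acomm m x b)) y - \<omega> (desc a (m b y)) x)"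
proof -
  have 1: "\<omega> (desc b (m a y)) x
    = \<omega> (acomm m a (B (acomm m b x))) y - \<omega> (acomm m a (acomm m (B b) x)) y" for a b
  proof -
    have "\<omega> (m (B b) (m a y)) x = - \<omega> (acomm m a (acomm m (B b) x)) y"
      by (simp add: form_left[of "B b"] form_left[of a] form_skew[of y])
    moreover have "\<omega> (m b (Q (m a y))) x = \<omega> (acomm m a (B (acomm m b x))) y"
      by (simp add: form_left[of b] form_Q form_left[of a] form_skew[of y])
    ultimately show ?thesis by (simp add: desc_def form_add)
  qed
  have 2: "acomm desc u v = acomm m (B u) v + acomm m u (B v) + sc l (acomm m u v)" for u v
    by (simp add: acomm_def desc_def Q_def m_add m_sc scale_right_distrib algebra_simps)
  have J: "\<omega> (acomm m u (acomm m v w)) y + \<omega> (acomm m v (acomm m w u)) y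
      + \<omega> (acomm m w (acomm m u v)) y = 0" for u v w
    using arg_cong[OF acomm_jacobi[of u v w], of "\<lambda>t. \<omega> t y"] by (simp add: form_add form_zero)
  show ?thesis
    unfolding form_mult[of _ x y] 1 2 acomm_add acomm_sc form_add form_sc
    \<comment> \<open>The terms containing \<open>B\<close> of an anticommutator cancel between the
      two halves. The rest is these three Jacobi identities, the last one multiplied by
      \<open>l\<close>.\<close>
    using J[of x "B a" b] J[of x a "B b"] J[of x a b]
    by (simp only: acomm_commute[of b x] acomm_commute[of a x] acomm_commute[of "B a" x]
        acomm_commute[of "B b" x]) algebra
qed

lemma beta_cocycle:
  fixes a b :: 'v
  defines "st \<equiv> dual_mul sc m r"
  shows "beta m (acomm st (\<omega> a) (\<omega> b)) =
    - (dual_map2 id (Rmul st (\<omega> b) + Lmul st (\<omega> b)) (beta m (\<omega> a)) + dual_map2 (Lmul st (\<omega> b)) id (beta m (\<omega> a)))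
    - (dual_map2 id (Lmul st (\<omega> a) + Rmul st (\<omega> a)) (beta m (\<omega> b)) + dual_map2 (Lmul st (\<omega> a)) id (beta m (\<omega> b)))"
proof (intro ext)
  fix x y
  \<comment> \<open>\<open>dual_map2\<close> applies operators to slices of \<open>beta\<close>,
    with one argument frozen. Writing each slice as a value of \<open>\<omega>\<close> makes
    \<open>dual_mul_form\<close> applicable.\<close>
  have fst_arg: "(\<lambda>u. \<omega> c (m u y)) = \<omega> (- m c y)" for c by (simp add: form_right form_minus fun_eq_iff)
  have snd_arg: "(\<lambda>v. \<omega> c (m u v)) = \<omega> (acomm m u c)" for c u by (simp add: form_mult)
  have desc_minus: "\<omega> (desc c (- d)) x = - \<omega> (desc c d) x" for c d
    using desc_sc(2)[of c "-1" d] by (simp add: form_minus)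
  have left: "dual_map2 (Lmul st (\<omega> d)) id (beta m (\<omega> c)) x y = - \<omega> (desc d (m c y)) x" for c d
    unfolding dual_map2_def beta_def id_apply fst_arg Lmul_def st_def dual_mul_form desc_minus ..
  have right: "dual_map2 id (Rmul st (\<omega> d) + Lmul st (\<omega> d)) (beta m (\<omega> c)) x y
      = \<omega> (acomm desc d (acomm m x c)) y"
    "dual_map2 id (Lmul st (\<omega> d) + Rmul st (\<omega> d)) (beta m (\<omega> c)) x y
      = \<omega> (acomm desc d (acomm m x c)) y" for c d
    unfolding dual_map2_def beta_def id_apply plus_fun_apply snd_arg Lmul_def Rmul_def st_def dual_mul_form
    by (simp_all add: acomm_def form_add)
  show "beta m (acomm st (\<omega> a) (\<omega> b)) x y =
    (- (dual_map2 id (Rmul st (\<omega> b) + Lmul st (\<omega> b)) (beta m (\<omega> a)) + dual_map2 (Lmul st (\<omega> b)) id (beta m (\<omega> a)))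
    - (dual_map2 id (Lmul st (\<omega> a) + Rmul st (\<omega> a)) (beta m (\<omega> b)) + dual_map2 (Lmul st (\<omega> a)) id (beta m (\<omega> b)))) x y"
    by (simp add: left right) (simp add: st_def acomm_dual_mul_form beta_def beta_identity)
qed

lemma bialgebra: "mock_pre_lie_bialgebra sc m r"
  unfolding mock_pre_lie_bialgebra_def Let_def
  using quadratic alpha_cocycle dual_mul_mock_pre_lie beta_cocycle
  by (auto simp: quadratic_rota_baxter_def dual_eq)

section \<open>Vanishing of \<open>[[r, r]]\<close>\<close>

lemma bracket_zero: "eq3 sc (bracket sc m r) 0"
proof -
  obtain ps where ps: "eq2 sc r (tensor_of_list ps)"
    using tensor_decomposition[OF finite_dimensional_vector_space_axioms r_tensor] by blast
  have "bracket_of_list m ps (\<omega> a) (\<omega> b) (\<omega> c) = 0" for a b c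
  proof -
    \<comment> \<open>Multiplicativity of \<open>Q\<close> on \<open>desc\<close> turns the product
      into \<open>Q (desc c b)\<close>, and the adjoint relation moves \<open>Q\<close> over to
      \<open>a\<close> as \<open>-B\<close>. Applied also with \<open>a\<close> and \<open>b\<close>
      exchanged, this rewrites the first two terms of the bracket.\<close>
    have 1: "\<omega> a (m (Q c) (Q b)) = \<omega> b (acomm m (Q c) (B a)) + \<omega> (B b) (acomm m c (B a))" for a b
    proof -
      have "\<omega> a (Q (desc c b)) = - \<omega> (B a) (desc c b)" by (simp add: form_B)
      then have "\<omega> a (m (Q c) (Q b)) = - \<omega> (B a) (m (Q c) b) - \<omega> (B a) (m c (B b))"
        unfolding Q_desc unfolding desc_eq form_add by simp
      then show ?thesis
        using form_skew[of "B a"] by (simp add: form_left)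
    qed
    \<comment> \<open>What is left of the bracket is minus this sum, which vanishes by invariance
      and skew-symmetry of the form.\<close>
    have 2: "\<omega> (B b) (acomm m c (B a)) + \<omega> (B a) (acomm m c (B b)) + \<omega> c (acomm m (B a) (B b)) = 0"
    proof -
      have "\<omega> (B b) (m c (B a)) = - \<omega> (B a) (acomm m c (B b))"
        by (metis form_skew form_left)
      moreover have "\<omega> (B b) (m (B a) c) = - \<omega> c (acomm m (B a) (B b))"
        by (metis form_skew form_left)
      ultimately show ?thesis by (simp add: acomm_def[of m c "B a"] form_add)
    qed
    show ?thesis
      unfolding bracket_of_list_apply[OF vs bilinear ps form_dual(1) form_dual(1) form_dual(1)]
        r_plus_form r_minus_form
      using 1[of a b] 1[of b a] 2 by algebra
  qed
  then have "eq3 sc (bracket_of_list m ps) 0" by (auto simp: eq3_def dual_eq)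
  with bracket_eq[OF vs bilinear ps] show ?thesis by (simp add: eq3_def)
qed

section \<open>The skew part of \<open>r\<close> and the triangular and factorizable cases\<close>

lemma skew_part_form: "skew_part r (\<omega> a) (\<omega> b) = - l * \<omega> b a / 2"
proof -
  have "\<omega> a (B b) = \<omega> b (B a) + l * \<omega> b a"
    using form_B[of b a] form_skew[of a "B b"] by (simp add: Q_def form_add form_sc)
  then show ?thesis by (simp add: skew_part_def r_form)
qed

text \<open>The skew part is a scalar multiple of the form carried to the dual, so it inherits the
  invariance of \<open>\<omega>\<close>.\<close>

lemma skew_part_invariant: "L_LR_invariant sc m (skew_part r)"
  unfolding L_LR_invariant_def eq2_def dual_eq
  by (auto simp: map2_def form_transpose skew_part_form form_acomm)

lemma quasi_triangular: "quasi_triangular sc m r"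
  by (simp add: quasi_triangular_def r_tensor bialgebra bracket_zero skew_part_invariant)

lemma triangular:
  assumes "l = 0"
  shows "triangular sc m r"
proof -
  have "r (\<omega> a) (\<omega> b) = r (\<omega> b) (\<omega> a)" for a b
    using skew_part_form[of a b] assms by (simp add: skew_part_def)
  then show ?thesis
    by (auto simp: triangular_def quasi_triangular symmetric_tensor_def eq2_def dual_eq)
qed

text \<open>Used twice: \<open>c = 1\<close> gives the isomorphism \<open>form_iso\<close>, and
  \<open>c = - l\<close> gives bijectivity of \<open>I_map\<close> for nonzero weight.\<close>

lemma dual_linear_isoI:
  assumes "c \<noteq> 0" and T: "\<And>a. T (\<omega> a) = sc c a"
  shows "dual_linear_iso sc T"
proof -
  have "bij_betw T (range \<omega>) UNIV"
    by (rule bij_betw_byWitness[where f' = "\<lambda>v. \<omega> (sc (inverse c) v)"]) (use assms in auto)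
  then show ?thesis
    unfolding dual_linear_iso_def dual_eq
    by (auto simp: form_vector_ops T scale_right_distrib mult.commute)
qed

lemma form_iso_dual_linear_iso: "dual_linear_iso sc (form_iso \<omega>)"
  by (rule dual_linear_isoI[of 1]) simp_all

lemma factorizable: "l \<noteq> 0 \<Longrightarrow> factorizable sc m r"
  by (simp add: factorizable_def quasi_triangular dual_linear_isoI[of "- l"] I_map_form)

end

theorem theorem5p6:
  fixes sc :: "'k::{alg_closed_field, field_char_0} \<Rightarrow> 'v::ab_group_add \<Rightarrow> 'v"
    and Basis :: "'v set"
    and m :: "'v \<Rightarrow> 'v \<Rightarrow> 'v"
    and l :: 'k
    and B :: "'v \<Rightarrow> 'v"
    and \<omega> :: "'v \<Rightarrow> 'v \<Rightarrow> 'k"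
    and r :: "('k, 'v) tens2"
  assumes "finite_dimensional_vector_space sc Basis"
    and "quadratic_rota_baxter sc m l B \<omega>"
    and "r = tensor_of_map (B \<circ> form_iso \<omega>)"
  shows "dual_linear_iso sc (form_iso \<omega>)
    \<and> r \<in> tensor_square sc
    \<and> (\<forall>\<xi>\<in>dual sc. r_plus sc r \<xi> = (B \<circ> form_iso \<omega>) \<xi>)
    \<and> eq3 sc (bracket sc m r) 0
    \<and> (l = 0 \<longrightarrow> triangular sc m r)
    \<and> (l \<noteq> 0 \<longrightarrow> factorizable sc m r)"
proof -
  interpret quadratic_rota_baxter_algebra sc Basis m l B \<omega>
    using assms(1,2) by (intro quadratic_rota_baxter_algebra.intro quadratic_rota_baxter_algebra_axioms.intro)
  show ?thesis
    unfolding assms(3)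
    using form_iso_dual_linear_iso r_tensor bracket_zero triangular factorizable
    by (auto simp: dual_eq r_plus_form)
qed

end
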